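(* Let $\alpha\in[0,1]$ and $\beta\in(0,1]$. Assume that: (a) there exists a continuous function $\tilde h:\Omega_1^2\to\mathbb R_+$ such that $\int_\Omega|k(x,y)-k(x_0,y)|\,d\mu(y)\le\tilde h(x,x_0)d(x,x_0)^\beta$ for all $x,x_0\in\Omega_1$; (b) $k(x,\cdot)$ is measurable for all $x\in\Omega_1$ and $\sup_{\xi\in\Omega_1}\int_\Omega|k(\xi,y)|\,d\mu(y)<\infty$; (c) $g:\Omega\times Z\to\mathbb R^p$ can be continuously extended to $\Omega\times\overline Z$. Then the Hammerstein operator $\mathscr H:U_\alpha\to C^\beta_d(\Omega_1)$, $\mathscr H(u):=\int_\Omega k(\cdot,y)g(y,u(y))\,d\mu(y)$, is well-defined, bounded and continuous.
   Context: Notation: $\mathbb R_+=[0,\infty)$; $|\cdot|$ denotes norms on finite-dimensional spaces, with the norm on matrices $\mathbb R^{d\times p}$ compatible with the vector norms ($|Aw|\le|A||w|$); $d(\cdot,\cdot)$ denotes the metric of any metric space considered, while $d$ alone is a dimension. For a metric space $X$ and $m\in\mathbb N$, $C^0_m(X)$ is the space of bounded continuous $u:X\to\mathbb R^m$ with norm $\|u\|_0=\sup_{x\in X}|u(x)|$. For $\alpha\in(0,1]$, $[u]_\alpha:=\sup_{x\neq\bar x}|u(x)-u(\bar x)|/d(x,\bar x)^\alpha$, and $C^\alpha_m(X)$ is the space of bounded $u:X\to\mathbb R^m$ with $[u]_\alpha<\infty$, normed by $\|u\|_\alpha=\max\{\|u\|_0,[u]_\alpha\}$. Setting: $\Omega,\Omega_1$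 are metric spaces, $\Omega$ is compact, $(\Omega,\mathfrak A,\mu)$ is a measure space with $\mu(\Omega)<\infty$ whose $\sigma$-algebra contains the Borel sets; measurability and integrability refer to it. $Z\subseteq\mathbb R^n$ is nonempty, $U_\alpha:=\{u:\Omega\to Z\mid u\in C^\alpha_n(\Omega)\}$ (a subset of the normed space $C^\alpha_n(\Omega)$), $k:\Omega_1\times\Omega\to\mathbb R^{d\times p}$ and $g:\Omega\times Z\to\mathbb R^p$ are functions. A map is bounded if it maps bounded sets to bounded sets.
   Formalization: In (a) the function h̃ is additionally required to be bounded on Ω₁² (automatic if Ω₁ is compact); without this the claim fails, e.g. Ω a point, Ω₁=ℝ, k(x,y)=sin(x²), g=1, β=1, h̃(x,x₀)=|x|+|x₀|. *)

theory Defs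
  imports "HOL-Analysis.Analysis"
begin

text \<open>Norms on finite-dimensional spaces are arbitrary, not necessarily the Euclidean one carried
  by the type class; they are therefore passed around as explicit functions.\<close>

definition is_norm :: "('v::real_vector \<Rightarrow> real) \<Rightarrow> bool" where
  "is_norm N \<longleftrightarrow>
     (\<forall>v. N v = 0 \<longleftrightarrow> v = 0) \<and>
     (\<forall>c v. N (c *\<^sub>R v) = \<bar>c\<bar> * N v) \<and>
     (\<forall>v w. N (v + w) \<le> N v + N w)"

definition compatible_norms ::
    "(real^'p^'d \<Rightarrow> real) \<Rightarrow> (real^'p \<Rightarrow> real) \<Rightarrow> (real^'d \<Rightarrow> real) \<Rightarrow> bool" where
  "compatible_norms NM NP ND \<longleftrightarrow> (\<forall>A w. ND (A *v w) \<le> NM A * NP w)"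

text \<open>Suprema of nonnegative reals are taken in \<^typ>\<open>ennreal\<close>: the empty supremum is then 0 and
  finiteness is expressible as being less than \<open>\<infinity>\<close>. A metric space is a subset \<open>X\<close> of a type of class
  \<^class>\<open>metric_space\<close>, and a function on \<open>X\<close> is represented by any total function; only its values
  on \<open>X\<close> enter below.\<close>

definition sup_norm :: "('v \<Rightarrow> real) \<Rightarrow> 'a set \<Rightarrow> ('a \<Rightarrow> 'v) \<Rightarrow> ennreal" where
  "sup_norm N X u = (SUP x\<in>X. ennreal (N (u x)))"

definition holder_seminorm ::
    "('v::minus \<Rightarrow> real) \<Rightarrow> real \<Rightarrow> 'a::metric_space set \<Rightarrow> ('a \<Rightarrow> 'v) \<Rightarrow> ennreal" where
  "holder_seminorm N \<alpha> X u =
     (SUP (x, x') \<in> {(x, x'). x \<in> X \<and> x' \<in> X \<and> x \<noteq> x'}.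
        ennreal (N (u x - u x') / dist x x' powr \<alpha>))"

text \<open>The exponent 0 stands for the bounded continuous functions with the supremum norm; it is not
  the instance \<open>\<alpha> = 0\<close> of the Hoelder condition.\<close>

definition holder_norm ::
    "('v::minus \<Rightarrow> real) \<Rightarrow> real \<Rightarrow> 'a::metric_space set \<Rightarrow> ('a \<Rightarrow> 'v) \<Rightarrow> ennreal" where
  "holder_norm N \<alpha> X u =
     (if \<alpha> = 0 then sup_norm N X u else max (sup_norm N X u) (holder_seminorm N \<alpha> X u))"

definition holder_space ::
    "('v::{minus,topological_space} \<Rightarrow> real) \<Rightarrow> real \<Rightarrow> 'a::metric_space set \<Rightarrow> ('a \<Rightarrow> 'v) set" where
  "holder_space N \<alpha> X =
     {u. sup_norm N X u < \<infinity> \<and>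
         (if \<alpha> = 0 then continuous_on X u else holder_seminorm N \<alpha> X u < \<infinity>)}"

definition holder_functions_into ::
    "('v::{minus,topological_space} \<Rightarrow> real) \<Rightarrow> real \<Rightarrow> 'a::metric_space set \<Rightarrow> 'v set \<Rightarrow> ('a \<Rightarrow> 'v) set" where
  "holder_functions_into N \<alpha> X Z = {u \<in> holder_space N \<alpha> X. \<forall>x\<in>X. u x \<in> Z}"

definition hammerstein ::
    "'a measure \<Rightarrow> ('b \<Rightarrow> 'a \<Rightarrow> real^'p^'d) \<Rightarrow> ('a \<times> 'z \<Rightarrow> real^'p) \<Rightarrow> ('a \<Rightarrow> 'z) \<Rightarrow> 'b \<Rightarrow> real^'d" where
  "hammerstein M k g u = (\<lambda>x. \<integral>y. k x y *v g (y, u y) \<partial>M)"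

definition bounded_map ::
    "('u \<Rightarrow> ennreal) \<Rightarrow> ('w \<Rightarrow> ennreal) \<Rightarrow> 'u set \<Rightarrow> ('u \<Rightarrow> 'w) \<Rightarrow> bool" where
  "bounded_map NU NW U T \<longleftrightarrow>
     (\<forall>B\<subseteq>U. (\<exists>r::real. \<forall>u\<in>B. NU u \<le> ennreal r) \<longrightarrow> (\<exists>R::real. \<forall>u\<in>B. NW (T u) \<le> ennreal R))"

definition norm_continuous_map ::
    "('u::minus \<Rightarrow> ennreal) \<Rightarrow> ('w::minus \<Rightarrow> ennreal) \<Rightarrow> 'u set \<Rightarrow> ('u \<Rightarrow> 'w) \<Rightarrow> bool" where
  "norm_continuous_map NU NW U T \<longleftrightarrow>
     (\<forall>u\<in>U. \<forall>\<epsilon>>0::real. \<exists>\<delta>>0::real. \<forall>v\<in>U.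
        NU (v - u) < ennreal \<delta> \<longrightarrow> NW (T v - T u) < ennreal \<epsilon>)"

end

theory Submission
  imports Defs
begin

text \<open>The Hammerstein operator factors as a substitution (Nemytskii) operator \<open>u \<mapsto> g(\<cdot>, u(\<cdot>))\<close>
  followed by the linear integral operator with kernel \<open>k\<close>, and the two factors are treated
  separately.

  The linear factor is bounded from bounded measurable functions with the supremum norm into the
  Hoelder functions on \<open>\<Omega>\<^sub>1\<close> (\<open>kernel_operator_bounded\<close>): the uniform bound on the integrals of
  \<open>\<bar>k(\<xi>, \<cdot>)\<bar>\<close> controls the supremum norm, and the Hoelder estimate for the kernel, with \<open>h\<close>
  replaced by an upper bound \<open>H\<close> of its values, controls the seminorm. Being linear, it also
  turns a uniform estimate for \<open>g(\<cdot>, v) - g(\<cdot>, u)\<close> into an estimate of the Hoelder norm of the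
  difference of the images.

  For the substitution operator, the functions \<open>u\<close> in a bounded set have all their values in one
  compact ball, so only the restriction of the continuous extension of \<open>g\<close> to a compact set
  \<open>\<Omega> \<times> (closure Z \<inter> cball 0 R)\<close> matters. It is bounded there, hence substitution is bounded
  (\<open>nemytskii_bounded\<close>), and uniformly continuous there, hence substitution is continuous with
  respect to uniform convergence (\<open>nemytskii_continuous\<close>). The Hoelder norm of \<open>u\<close>
  dominates its supremum norm, so both properties carry over to the Hoelder norm.

  As the conclusions are qualitative, each arbitrary norm is compared with the Euclidean one
  (\<open>norm_equivalence\<close>) and constants are not tracked.\<close>

section \<open>Norms on finite-dimensional spaces\<close>

lemma is_norm_nonneg:
  assumes "is_norm N"
  shows "0 \<le> N v"
proof -
  have "N 0 = 0" "N (v + (-1) *\<^sub>R v) \<le> N v + N ((-1) *\<^sub>R v)" "N ((-1) *\<^sub>R v) = \<bar>-1\<bar> * N v"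
    using assms unfolding is_norm_def by blast+
  then show ?thesis by simp
qed

lemma is_norm_sum_le:
  fixes f :: "'b \<Rightarrow> 'v::real_vector"
  assumes "is_norm N"
  shows "N (sum f A) \<le> (\<Sum>a\<in>A. N (f a))"
proof (induction A rule: infinite_finite_induct)
  case (insert x F)
  have "N (f x + sum f F) \<le> N (f x) + N (sum f F)"
    using assms unfolding is_norm_def by blast
  then show ?case using insert by simp
next
  have "N 0 = 0" using assms unfolding is_norm_def by blast
  then show "N (sum f {}) \<le> (\<Sum>a\<in>{}. N (f a))" by simp
  fix A :: "'b set" assume "infinite A"
  then show "N (sum f A) \<le> (\<Sum>a\<in>A. N (f a))" using \<open>N 0 = 0\<close> by simp
qed

lemma is_norm_le_norm:
  fixes N :: "'v::euclidean_space \<Rightarrow> real"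
  assumes "is_norm N"
  obtains C where "0 < C" "\<And>v. N v \<le> C * norm v"
proof
  define C where "C = (\<Sum>b\<in>Basis. N b) + 1"
  have nn: "0 \<le> N v" for v using assms by (rule is_norm_nonneg)
  show "0 < C" unfolding C_def by (smt (verit) sum_nonneg nn)
  fix v :: 'v
  have "N v = N (\<Sum>b\<in>Basis. (v \<bullet> b) *\<^sub>R b)" by (simp add: euclidean_representation)
  also have "\<dots> \<le> (\<Sum>b\<in>Basis. N ((v \<bullet> b) *\<^sub>R b))" by (rule is_norm_sum_le[OF assms])
  also have "\<dots> = (\<Sum>b\<in>Basis. \<bar>v \<bullet> b\<bar> * N b)" using assms by (simp add: is_norm_def)
  also have "\<dots> \<le> (\<Sum>b\<in>Basis. norm v * N b)"
    by (intro sum_mono mult_right_mono nn Basis_le_norm)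
  also have "\<dots> = norm v * (\<Sum>b\<in>Basis. N b)" by (simp add: sum_distrib_left)
  also have "\<dots> \<le> C * norm v" unfolding C_def by (simp add: algebra_simps)
  finally show "N v \<le> C * norm v" .
qed

lemma is_norm_continuous:
  fixes N :: "'v::euclidean_space \<Rightarrow> real"
  assumes "is_norm N"
  shows "continuous_on S N"
proof -
  obtain C where C: "0 < C" "\<And>v. N v \<le> C * norm v"
    using is_norm_le_norm[OF assms] by blast
  have tri: "N v \<le> N w + C * dist v w" for v w
  proof -
    have "N (w + (v - w)) \<le> N w + N (v - w)" using assms unfolding is_norm_def by blast
    then show ?thesis using C(2)[of "v - w"] by (simp add: dist_norm)
  qed
  have "C-lipschitz_on S N"
  proof (rule lipschitz_onI)
    fix v w
    show "dist (N v) (N w) \<le> C * dist v w"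
      using tri[of v w] tri[of w v] by (simp add: dist_real_def dist_commute abs_le_iff)
  qed (use C in simp)
  then show ?thesis by (rule lipschitz_on_continuous_on)
qed

text \<open>The reverse comparison comes from compactness of the unit sphere: the continuous function
  \<open>N\<close> attains a positive minimum there.\<close>

lemma norm_equivalence:
  fixes N :: "'v::euclidean_space \<Rightarrow> real"
  assumes "is_norm N"
  obtains C where "0 < C" "\<And>v. N v \<le> C * norm v" "\<And>v. norm v \<le> C * N v"
proof -
  obtain C where C: "0 < C" "\<And>v. N v \<le> C * norm v"
    using is_norm_le_norm[OF assms] by blast
  obtain v :: 'v where "norm v = 1" using vector_choose_size[of 1] by auto
  then have "sphere (0::'v) 1 \<noteq> {}" by (metis dist_0_norm empty_iff mem_sphere)
  with continuous_attains_inf[OF compact_sphere _ is_norm_continuous[OF assms]]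
  obtain e :: 'v where e: "norm e = 1" "\<And>v. norm v = 1 \<Longrightarrow> N e \<le> N v"
    by (metis dist_0_norm mem_sphere)
  have "N e \<noteq> 0" using assms e(1) unfolding is_norm_def by force
  then have pos: "0 < N e" using is_norm_nonneg[OF assms, of e] by linarith
  have low: "N e * norm v \<le> N v" for v
  proof (cases "v = 0")
    case True
    then show ?thesis using is_norm_nonneg[OF assms] by simp
  next
    case False
    have "N e \<le> N ((1 / norm v) *\<^sub>R v)" using False by (intro e(2)) simp
    also have "\<dots> = \<bar>1 / norm v\<bar> * N v" using assms unfolding is_norm_def by blast
    finally show ?thesis using False by (simp add: field_simps)
  qed
  show ?thesis
  proof
    show "0 < max C (1 / N e)" using C by simp
    fix v
    show "N v \<le> max C (1 / N e) * norm v"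
      using C(2)[of v] mult_right_mono[of C "max C (1 / N e)" "norm v"] by simp
    have "norm v \<le> (1 / N e) * N v" using low[of v] pos by (simp add: field_simps)
    also have "\<dots> \<le> max C (1 / N e) * N v"
      using is_norm_nonneg[OF assms, of v] by (intro mult_right_mono) auto
    finally show "norm v \<le> max C (1 / N e) * N v" .
  qed
qed

section \<open>Hoelder functions\<close>

lemma sup_norm_le_holder_norm: "sup_norm N X u \<le> holder_norm N \<alpha> X u"
  by (simp add: holder_norm_def)

lemma sup_norm_le_iff:
  "0 \<le> m \<Longrightarrow> sup_norm N X u \<le> ennreal m \<longleftrightarrow> (\<forall>x\<in>X. N (u x) \<le> m)"
  by (simp add: sup_norm_def SUP_le_iff ennreal_le_iff)

lemma holder_norm_cong:
  assumes "\<And>x. x \<in> X \<Longrightarrow> u x = v x"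
  shows "holder_norm N \<alpha> X u = holder_norm N \<alpha> X v"
proof -
  have "sup_norm N X u = sup_norm N X v"
    unfolding sup_norm_def using assms by (intro SUP_cong) auto
  moreover have "holder_seminorm N \<alpha> X u = holder_seminorm N \<alpha> X v"
    unfolding holder_seminorm_def using assms by (intro SUP_cong) auto
  ultimately show ?thesis by (simp add: holder_norm_def)
qed

lemma holder_norm_leI:
  assumes "\<alpha> \<noteq> 0"
    and "\<And>x. x \<in> X \<Longrightarrow> N (u x) \<le> m"
    and "\<And>x x'. x \<in> X \<Longrightarrow> x' \<in> X \<Longrightarrow> N (u x - u x') \<le> m * dist x x' powr \<alpha>"
  shows "holder_norm N \<alpha> X u \<le> ennreal m"
proof -
  have "sup_norm N X u \<le> ennreal m"
    unfolding sup_norm_def by (intro SUP_least ennreal_leI assms)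
  moreover have "holder_seminorm N \<alpha> X u \<le> ennreal m"
    unfolding holder_seminorm_def
    by (intro SUP_least) (auto intro!: ennreal_leI assms(3) simp: divide_le_eq)
  ultimately show ?thesis using assms(1) by (simp add: holder_norm_def)
qed

lemma holder_space_sup_bound:
  assumes "u \<in> holder_space N \<alpha> X"
  obtains r where "0 \<le> r" "\<And>x. x \<in> X \<Longrightarrow> N (u x) \<le> r"
proof -
  have "sup_norm N X u < \<infinity>" using assms by (simp add: holder_space_def)
  then obtain r where "0 \<le> r" "sup_norm N X u = ennreal r"
    by (cases "sup_norm N X u") auto
  then show ?thesis using that sup_norm_le_iff[of r N X u] by simp
qed

lemma holder_space_continuous:
  fixes u :: "'a::metric_space \<Rightarrow> 'v::euclidean_space"
  assumes N: "is_norm N" and "0 \<le> \<alpha>" and u: "u \<in> holder_space N \<alpha> X"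
  shows "continuous_on X u"
proof (cases "\<alpha> = 0")
  case True
  then show ?thesis using u by (simp add: holder_space_def)
next
  case False
  then have \<alpha>: "0 < \<alpha>" using assms by simp
  have "holder_seminorm N \<alpha> X u < \<infinity>" using u False by (simp add: holder_space_def)
  then obtain c where c: "0 \<le> c" "holder_seminorm N \<alpha> X u = ennreal c"
    by (cases "holder_seminorm N \<alpha> X u") auto
  obtain C where C: "0 < C" "\<And>v. norm v \<le> C * N v" using norm_equivalence[OF N] by metis
  have holder: "N (u x' - u x) \<le> c * dist x' x powr \<alpha>" if "x \<in> X" "x' \<in> X" "x' \<noteq> x" for x x'
  proof -
    have "ennreal (N (u x' - u x) / dist x' x powr \<alpha>) \<le> holder_seminorm N \<alpha> X u"
      unfolding holder_seminorm_def using that by (intro SUP_upper2[of "(x', x)"]) auto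
    then show ?thesis using c that by (simp add: ennreal_le_iff divide_le_eq)
  qed
  show ?thesis unfolding continuous_on_def
  proof
    fix x assume x: "x \<in> X"
    have "((\<lambda>x'. dist x' x) \<longlongrightarrow> 0) (at x within X)"
      using tendsto_dist[OF tendsto_ident_at tendsto_const, of x x X] by simp
    then have "((\<lambda>x'. C * (c * dist x' x powr \<alpha>)) \<longlongrightarrow> 0) (at x within X)"
      using \<alpha> by (auto intro!: tendsto_mult_right_zero tendsto_zero_powrI)
    moreover have "\<forall>\<^sub>F x' in at x within X. norm (u x' - u x) \<le> C * (c * dist x' x powr \<alpha>)"
      unfolding eventually_at_filter
      using x holder C by (intro always_eventually) (meson order_trans mult_left_mono less_imp_le)
    ultimately have "((\<lambda>x'. u x' - u x) \<longlongrightarrow> 0) (at x within X)"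
      by (rule Lim_null_comparison[rotated])
    then show "(u \<longlongrightarrow> u x) (at x within X)" by (rule LIM_zero_cancel)
  qed
qed

section \<open>The linear integral operator\<close>

text \<open>The basic estimate behind both parts of the Hoelder norm; it is applied with \<open>A\<close> a slice
  of the kernel and with \<open>A\<close> a difference of two slices.\<close>

lemma integral_matrix_vector_bound:
  fixes A :: "'a \<Rightarrow> real^'p^'d" and f :: "'a \<Rightarrow> real^'p"
  assumes L: "0 \<le> L" "\<And>B w. norm (B *v w) \<le> L * NM B * norm w" and NM: "is_norm NM"
    and A[measurable]: "A \<in> borel_measurable M" and f[measurable]: "f \<in> borel_measurable M"
    and m: "0 \<le> m" "\<And>y. y \<in> space M \<Longrightarrow> norm (f y) \<le> m"
    and b: "0 \<le> b" "(\<integral>\<^sup>+ y. ennreal (NM (A y)) \<partial>M) \<le> ennreal b"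
  shows "integrable M (\<lambda>y. A y *v f y)" "norm (\<integral>y. A y *v f y \<partial>M) \<le> L * m * b"
proof -
  have meas[measurable]: "(\<lambda>y. A y *v f y) \<in> borel_measurable M"
    by (rule borel_measurable_continuous_Pair[OF A f])
       (unfold matrix_vector_mult_def, intro continuous_intros)
  have [measurable]: "NM \<in> borel_measurable borel"
    by (intro borel_measurable_continuous_onI is_norm_continuous NM)
  have "(\<integral>\<^sup>+ y. ennreal (norm (A y *v f y)) \<partial>M) \<le> (\<integral>\<^sup>+ y. ennreal (L * m) * ennreal (NM (A y)) \<partial>M)"
  proof (rule nn_integral_mono)
    fix y assume "y \<in> space M"
    have "norm (A y *v f y) \<le> L * NM (A y) * norm (f y)" by (rule L)
    also have "\<dots> \<le> L * NM (A y) * m"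
      using \<open>y \<in> space M\<close> L is_norm_nonneg[OF NM] by (intro mult_left_mono m) auto
    finally show "ennreal (norm (A y *v f y)) \<le> ennreal (L * m) * ennreal (NM (A y))"
      using L m is_norm_nonneg[OF NM] by (simp add: ennreal_mult'[symmetric] ac_simps ennreal_leI)
  qed
  also have "\<dots> = ennreal (L * m) * (\<integral>\<^sup>+ y. ennreal (NM (A y)) \<partial>M)"
    by (rule nn_integral_cmult) measurable
  also have "\<dots> \<le> ennreal (L * m) * ennreal b" by (intro mult_left_mono b) simp
  also have "\<dots> = ennreal (L * m * b)" using L m b by (simp add: ennreal_mult)
  finally have bound: "(\<integral>\<^sup>+ y. ennreal (norm (A y *v f y)) \<partial>M) \<le> ennreal (L * m * b)" .
  show int: "integrable M (\<lambda>y. A y *v f y)"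
    using bound by (intro integrableI_bounded meas) (auto intro: le_less_trans)
  have "ennreal (norm (\<integral>y. A y *v f y \<partial>M)) \<le> ennreal (L * m * b)"
    using integral_norm_bound_ennreal[OF int] bound by (rule order_trans)
  then show "norm (\<integral>y. A y *v f y \<partial>M) \<le> L * m * b" using L m b by (simp add: ennreal_le_iff)
qed

text \<open>Boundedness of the linear factor, with one constant for all densities \<open>f\<close>. It is also
  applied to differences \<open>f = g(\<cdot>, v) - g(\<cdot>, u)\<close> and gives continuity of the Hammerstein operator.\<close>

lemma kernel_operator_bounded:
  fixes k :: "'b::metric_space \<Rightarrow> 'a \<Rightarrow> real^'p^'d"
    and NP :: "real^'p \<Rightarrow> real" and ND :: "real^'d \<Rightarrow> real" and NM :: "real^'p^'d \<Rightarrow> real"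
  assumes norms: "is_norm NP" "is_norm ND" "is_norm NM" "compatible_norms NM NP ND"
    and \<beta>: "\<beta> \<noteq> 0"
    and holder: "\<And>x x'. x \<in> X \<Longrightarrow> x' \<in> X \<Longrightarrow>
        (\<integral>\<^sup>+ y. ennreal (NM (k x y - k x' y)) \<partial>M) \<le> ennreal (H * dist x x' powr \<beta>)"
    and meas: "\<And>x. x \<in> X \<Longrightarrow> k x \<in> borel_measurable M"
    and sup: "(SUP x\<in>X. \<integral>\<^sup>+ y. ennreal (NM (k x y)) \<partial>M) < \<infinity>"
  obtains D where "0 < D"
    and "\<And>f m x. \<lbrakk>f \<in> borel_measurable M; 0 \<le> m; \<And>y. y \<in> space M \<Longrightarrow> norm (f y) \<le> m; x \<in> X\<rbrakk>
          \<Longrightarrow> integrable M (\<lambda>y. k x y *v f y)"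
    and "\<And>f m. \<lbrakk>f \<in> borel_measurable M; 0 \<le> m; \<And>y. y \<in> space M \<Longrightarrow> norm (f y) \<le> m\<rbrakk>
          \<Longrightarrow> holder_norm ND \<beta> X (\<lambda>x. \<integral>y. k x y *v f y \<partial>M) \<le> ennreal (D * m)"
proof -
  obtain CP where CP: "0 < CP" "\<And>v. NP v \<le> CP * norm v"
    using norm_equivalence[OF norms(1)] by metis
  obtain CD where CD: "0 < CD" "\<And>v. ND v \<le> CD * norm v" "\<And>v. norm v \<le> CD * ND v"
    using norm_equivalence[OF norms(2)] by metis
  define L where "L = CD * CP"
  have L: "0 < L" using CD CP by (simp add: L_def)
  have mult_le: "norm (A *v w) \<le> L * NM A * norm w" for A w
  proof -
    have "norm (A *v w) \<le> CD * ND (A *v w)" by (rule CD)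
    also have "\<dots> \<le> CD * (NM A * NP w)"
      using norms(4) CD unfolding compatible_norms_def by (intro mult_left_mono) auto
    also have "\<dots> \<le> CD * (NM A * (CP * norm w))"
      using CP CD is_norm_nonneg[OF norms(3)] by (intro mult_left_mono) auto
    finally show ?thesis by (simp add: L_def ac_simps)
  qed
  obtain B where B: "0 \<le> B" "(SUP x\<in>X. \<integral>\<^sup>+ y. ennreal (NM (k x y)) \<partial>M) = ennreal B"
    using sup by (cases "SUP x\<in>X. \<integral>\<^sup>+ y. ennreal (NM (k x y)) \<partial>M") auto
  have slice: "(\<integral>\<^sup>+ y. ennreal (NM (k x y)) \<partial>M) \<le> ennreal B" if "x \<in> X" for x
    unfolding B(2)[symmetric] using that by (rule SUP_upper)
  define K where "K = B + max H 0"
  have K: "0 \<le> K" "B \<le> K" "H \<le> K" using B by (auto simp: K_def)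
  have slice_diff: "(\<integral>\<^sup>+ y. ennreal (NM (k x y - k x' y)) \<partial>M) \<le> ennreal (K * dist x x' powr \<beta>)"
    if "x \<in> X" "x' \<in> X" for x x'
    using holder[OF that] by (rule order_trans) (intro ennreal_leI mult_right_mono K, simp)
  define D where "D = CD * L * K + 1"
  have D: "CD * (L * m * K) \<le> D * m" if "0 \<le> m" for m
    using that by (simp add: D_def algebra_simps)
  show ?thesis
  proof
    show "0 < D" using CD L K by (simp add: D_def add_nonneg_pos)
  next
    fix f :: "'a \<Rightarrow> real^'p" and m x assume "f \<in> borel_measurable M" "0 \<le> m" "\<And>y. y \<in> space M \<Longrightarrow> norm (f y) \<le> m" "x \<in> X"
    then show "integrable M (\<lambda>y. k x y *v f y)"
      using L B by (intro integral_matrix_vector_bound(1)[OF _ mult_le norms(3) _ _ _ _ _ slice] meas) auto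
  next
    fix f :: "'a \<Rightarrow> real^'p" and m assume f: "f \<in> borel_measurable M" and m: "0 \<le> m" "\<And>y. y \<in> space M \<Longrightarrow> norm (f y) \<le> m"
    have bound: "integrable M (\<lambda>y. A y *v f y)" "norm (\<integral>y. A y *v f y \<partial>M) \<le> L * m * b"
      if "A \<in> borel_measurable M" "0 \<le> b" "(\<integral>\<^sup>+ y. ennreal (NM (A y)) \<partial>M) \<le> ennreal b" for A b
      by (rule integral_matrix_vector_bound[OF less_imp_le[OF L] mult_le norms(3) that(1) f m(1) _ that(2,3)],
          erule m(2))+
    show "holder_norm ND \<beta> X (\<lambda>x. \<integral>y. k x y *v f y \<partial>M) \<le> ennreal (D * m)"
    proof (rule holder_norm_leI[OF \<beta>])
      fix x assume x: "x \<in> X"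
      have "ND (\<integral>y. k x y *v f y \<partial>M) \<le> CD * norm (\<integral>y. k x y *v f y \<partial>M)" by (rule CD)
      also have "\<dots> \<le> CD * (L * m * B)"
        using CD bound(2)[OF meas[OF x] B(1) slice[OF x]] by (intro mult_left_mono) auto
      also have "\<dots> \<le> CD * (L * m * K)" using CD L m K by (intro mult_left_mono) auto
      also have "\<dots> \<le> D * m" by (rule D[OF m(1)])
      finally show "ND (\<integral>y. k x y *v f y \<partial>M) \<le> D * m" .
    next
      fix x x' assume x: "x \<in> X" "x' \<in> X"
      have int: "integrable M (\<lambda>y. k z y *v f y)" if "z \<in> X" for z
        by (rule bound(1)[OF meas[OF that] B(1) slice[OF that]])
      let ?d = "dist x x' powr \<beta>"
      have "(\<integral>y. k x y *v f y \<partial>M) - (\<integral>y. k x' y *v f y \<partial>M) = (\<integral>y. (k x y - k x' y) *v f y \<partial>M)"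
        unfolding matrix_vector_mult_diff_rdistrib
        by (rule Bochner_Integration.integral_diff[symmetric]) (intro int x)+
      then have "ND ((\<integral>y. k x y *v f y \<partial>M) - (\<integral>y. k x' y *v f y \<partial>M))
          \<le> CD * norm (\<integral>y. (k x y - k x' y) *v f y \<partial>M)" using CD(2) by simp
      also have "\<dots> \<le> CD * (L * m * (K * ?d))"
        using CD K x by (intro mult_left_mono bound(2) slice_diff borel_measurable_diff meas) auto
      also have "\<dots> = CD * (L * m * K) * ?d" by simp
      also have "\<dots> \<le> D * m * ?d" by (intro mult_right_mono D m) simp
      finally show "ND ((\<integral>y. k x y *v f y \<partial>M) - (\<integral>y. k x' y *v f y \<partial>M)) \<le> D * m * ?d" .
    qed
  qed
qed

section \<open>The substitution operator\<close>

lemma nemytskii_bounded: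
  fixes G :: "'a::metric_space \<times> 'v::euclidean_space \<Rightarrow> 'w::real_normed_vector"
  assumes "compact \<Omega>" "continuous_on (\<Omega> \<times> closure Z) G"
  obtains m where "0 \<le> m" "\<And>y z. \<lbrakk>y \<in> \<Omega>; z \<in> Z; norm z \<le> r\<rbrakk> \<Longrightarrow> norm (G (y, z)) \<le> m"
proof -
  let ?S = "\<Omega> \<times> (closure Z \<inter> cball 0 r)"
  have "compact ?S"
    using assms(1) by (intro compact_Times closed_Int_compact) auto
  moreover have "continuous_on ?S G" using assms(2) by (rule continuous_on_subset) auto
  ultimately have "bounded (G ` ?S)" by (intro compact_imp_bounded compact_continuous_image)
  then obtain m where m: "0 < m" "\<forall>w\<in>G ` ?S. norm w \<le> m" by (auto simp: bounded_pos)
  show ?thesis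
  proof
    fix y z assume "y \<in> \<Omega>" "z \<in> Z" "norm z \<le> r"
    then have "(y, z) \<in> ?S" using closure_subset by auto
    then show "norm (G (y, z)) \<le> m" using m by blast
  qed (use m in simp)
qed

text \<open>The modulus of continuity may depend on the bound \<open>r\<close> for the reference point only: a
  perturbation smaller than 1 stays in the ball of radius \<open>r + 1\<close>, where \<open>G\<close> is uniformly
  continuous.\<close>

lemma nemytskii_continuous:
  fixes G :: "'a::metric_space \<times> 'v::euclidean_space \<Rightarrow> 'w::real_normed_vector"
  assumes "compact \<Omega>" "continuous_on (\<Omega> \<times> closure Z) G" "0 < \<epsilon>"
  obtains \<delta> where "0 < \<delta>"
    "\<And>y z z'. \<lbrakk>y \<in> \<Omega>; z \<in> Z; z' \<in> Z; norm z \<le> r; norm (z' - z) < \<delta>\<rbrakk>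
       \<Longrightarrow> norm (G (y, z') - G (y, z)) < \<epsilon>"
proof -
  let ?S = "\<Omega> \<times> (closure Z \<inter> cball 0 (r + 1))"
  have "compact ?S"
    using assms(1) by (intro compact_Times closed_Int_compact) auto
  moreover have "continuous_on ?S G" using assms(2) by (rule continuous_on_subset) auto
  ultimately have "uniformly_continuous_on ?S G" by (intro compact_uniformly_continuous)
  then obtain \<delta> where \<delta>: "0 < \<delta>"
      "\<And>s t. \<lbrakk>s \<in> ?S; t \<in> ?S; dist t s < \<delta>\<rbrakk> \<Longrightarrow> dist (G t) (G s) < \<epsilon>"
    using assms(3) unfolding uniformly_continuous_on_def by metis
  show ?thesis
  proof
    show "0 < min \<delta> 1" using \<delta> by simp
    fix y z z' assume *: "y \<in> \<Omega>" "z \<in> Z" "z' \<in> Z" "norm z \<le> r" "norm (z' - z) < min \<delta> 1"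
    have "norm z' \<le> r + 1" using * norm_triangle_sub[of z' z] by simp
    then have "(y, z) \<in> ?S" "(y, z') \<in> ?S" using * closure_subset by auto
    moreover have "dist (y, z') (y, z) < \<delta>" using * by (simp add: dist_Pair_Pair dist_norm)
    ultimately show "norm (G (y, z') - G (y, z)) < \<epsilon>" using \<delta>(2) by (simp add: dist_norm)
  qed
qed

lemma nemytskii_measurable:
  fixes G :: "'a::metric_space \<times> 'v::euclidean_space \<Rightarrow> 'w::real_normed_vector"
  assumes M: "sets (restrict_space borel (space M)) \<subseteq> sets M"
    and G: "continuous_on (space M \<times> closure Z) G"
    and u: "continuous_on (space M) u" "\<And>y. y \<in> space M \<Longrightarrow> u y \<in> Z"
  shows "(\<lambda>y. G (y, u y)) \<in> borel_measurable M"
proof -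
  have "continuous_on (space M) (\<lambda>y. G (y, u y))"
    using u closure_subset[of Z] by (intro continuous_on_compose2[OF G] continuous_intros) auto
  then have "(\<lambda>y. G (y, u y)) \<in> borel_measurable (restrict_space borel (space M))"
    by (rule borel_measurable_continuous_on_restrict)
  moreover have "space (restrict_space borel (space M)) = space M"
    by (simp add: space_restrict_space)
  ultimately show ?thesis using M unfolding measurable_def by auto
qed

section \<open>The Hammerstein operator\<close>

theorem theorem3p9:
  fixes \<Omega> :: "'a::metric_space set" and \<Omega>\<^sub>1 :: "'b::metric_space set"
    and M :: "'a measure"
    and Z :: "(real^'n) set"
    and k :: "'b \<Rightarrow> 'a \<Rightarrow> real^'p^'d"
    and g :: "'a \<times> (real^'n) \<Rightarrow> real^'p"
    and N\<^sub>n :: "real^'n \<Rightarrow> real" and N\<^sub>p :: "real^'p \<Rightarrow> real" and N\<^sub>d :: "real^'d \<Rightarrow> real"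
    and N\<^sub>M :: "real^'p^'d \<Rightarrow> real"
    and \<alpha> \<beta> :: real
  assumes norms: "is_norm N\<^sub>n" "is_norm N\<^sub>p" "is_norm N\<^sub>d" "is_norm N\<^sub>M" "compatible_norms N\<^sub>M N\<^sub>p N\<^sub>d"
    and \<Omega>: "compact \<Omega>"
    and M: "space M = \<Omega>" "sets (restrict_space borel \<Omega>) \<subseteq> sets M" "emeasure M \<Omega> < \<infinity>"
    and Z: "Z \<noteq> {}"
    and exponents: "0 \<le> \<alpha>" "\<alpha> \<le> 1" "0 < \<beta>" "\<beta> \<le> 1"
    and a: "\<exists>h :: 'b \<times> 'b \<Rightarrow> real.
        continuous_on (\<Omega>\<^sub>1 \<times> \<Omega>\<^sub>1) h \<and> bounded (h ` (\<Omega>\<^sub>1 \<times> \<Omega>\<^sub>1)) \<and>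
        (\<forall>x\<in>\<Omega>\<^sub>1. \<forall>x\<^sub>0\<in>\<Omega>\<^sub>1. 0 \<le> h (x, x\<^sub>0) \<and>
           (\<integral>\<^sup>+ y. ennreal (N\<^sub>M (k x y - k x\<^sub>0 y)) \<partial>M) \<le> ennreal (h (x, x\<^sub>0) * dist x x\<^sub>0 powr \<beta>))"
    and b: "\<forall>x\<in>\<Omega>\<^sub>1. k x \<in> borel_measurable M"
        "(SUP \<xi>\<in>\<Omega>\<^sub>1. \<integral>\<^sup>+ y. ennreal (N\<^sub>M (k \<xi> y)) \<partial>M) < \<infinity>"
    and c: "\<exists>G. continuous_on (\<Omega> \<times> closure Z) G \<and> (\<forall>y\<in>\<Omega>. \<forall>z\<in>Z. G (y, z) = g (y, z))"
  defines "U \<equiv> holder_functions_into N\<^sub>n \<alpha> \<Omega> Z"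
  shows "(\<forall>u\<in>U. (\<forall>x\<in>\<Omega>\<^sub>1. integrable M (\<lambda>y. k x y *v g (y, u y))) \<and>
                 hammerstein M k g u \<in> holder_space N\<^sub>d \<beta> \<Omega>\<^sub>1) \<and>
         bounded_map (holder_norm N\<^sub>n \<alpha> \<Omega>) (holder_norm N\<^sub>d \<beta> \<Omega>\<^sub>1) U (hammerstein M k g) \<and>
         norm_continuous_map (holder_norm N\<^sub>n \<alpha> \<Omega>) (holder_norm N\<^sub>d \<beta> \<Omega>\<^sub>1) U (hammerstein M k g)"
  proof -
  obtain h :: "'b \<times> 'b \<Rightarrow> real" where h: "bounded (h ` (\<Omega>\<^sub>1 \<times> \<Omega>\<^sub>1))"
    "\<And>x x'. x \<in> \<Omega>\<^sub>1 \<Longrightarrow> x' \<in> \<Omega>\<^sub>1 \<Longrightarrow>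
       (\<integral>\<^sup>+ y. ennreal (N\<^sub>M (k x y - k x' y)) \<partial>M) \<le> ennreal (h (x, x') * dist x x' powr \<beta>)"
    using a by (elim exE conjE) (rule that, assumption, blast)
  obtain H where H: "\<And>x x'. x \<in> \<Omega>\<^sub>1 \<Longrightarrow> x' \<in> \<Omega>\<^sub>1 \<Longrightarrow> h (x, x') \<le> H"
    using h(1) unfolding bounded_iff by (auto simp: abs_le_iff)
  have kernel_holder: "(\<integral>\<^sup>+ y. ennreal (N\<^sub>M (k x y - k x' y)) \<partial>M) \<le> ennreal (H * dist x x' powr \<beta>)"
    if "x \<in> \<Omega>\<^sub>1" "x' \<in> \<Omega>\<^sub>1" for x x'
    using h(2)[OF that] by (rule order_trans) (intro ennreal_leI mult_right_mono H that, simp)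
  obtain D where D: "0 < D"
    and integrable: "\<And>f m x. \<lbrakk>f \<in> borel_measurable M; 0 \<le> m; \<And>y. y \<in> space M \<Longrightarrow> norm (f y) \<le> m; x \<in> \<Omega>\<^sub>1\<rbrakk>
          \<Longrightarrow> integrable M (\<lambda>y. k x y *v f y)"
    and operator: "\<And>f m. \<lbrakk>f \<in> borel_measurable M; 0 \<le> m; \<And>y. y \<in> space M \<Longrightarrow> norm (f y) \<le> m\<rbrakk>
          \<Longrightarrow> holder_norm N\<^sub>d \<beta> \<Omega>\<^sub>1 (\<lambda>x. \<integral>y. k x y *v f y \<partial>M) \<le> ennreal (D * m)"
    by (rule kernel_operator_bounded[OF norms(2,3,4,5) less_imp_neq[OF exponents(3), symmetric]
        kernel_holder bspec[OF b(1)] b(2)], assumption+, rule that) blast+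
  obtain G where G: "continuous_on (\<Omega> \<times> closure Z) G" "\<And>y z. y \<in> \<Omega> \<Longrightarrow> z \<in> Z \<Longrightarrow> G (y, z) = g (y, z)"
    using c by blast
  obtain C where C: "0 < C" "\<And>v. norm v \<le> C * N\<^sub>n v" using norm_equivalence[OF norms(1)] by metis

  have U_Z: "u y \<in> Z" if "u \<in> U" "y \<in> \<Omega>" for u y
    using that by (simp add: U_def holder_functions_into_def)
  have U_space: "u \<in> holder_space N\<^sub>n \<alpha> \<Omega>" if "u \<in> U" for u
    using that by (simp add: U_def holder_functions_into_def)
  have meas: "(\<lambda>y. g (y, u y)) \<in> borel_measurable M" if u: "u \<in> U" for u
  proof -
    have "(\<lambda>y. G (y, u y)) \<in> borel_measurable M"
    proof (rule nemytskii_measurable)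
      show "sets (restrict_space borel (space M)) \<subseteq> sets M" using M by simp
      show "continuous_on (space M \<times> closure Z) G" using M G by simp
      show "continuous_on (space M) u"
        using M holder_space_continuous[OF norms(1) exponents(1) U_space[OF u]] by simp
      show "u y \<in> Z" if "y \<in> space M" for y using that M U_Z[OF u] by simp
    qed
    then show ?thesis
      by (rule measurable_cong[THEN iffD1, rotated]) (use M G(2) U_Z[OF u] in simp)
  qed

  \<comment> \<open>One constant \<open>m\<close> serves all \<open>u\<close> with values in a given ball; this gives integrability,
     membership in the Hoelder space and boundedness together.\<close>
  have bound: "\<exists>m\<ge>0. \<forall>u\<in>U. (\<forall>y\<in>\<Omega>. N\<^sub>n (u y) \<le> r) \<longrightarrow> (\<forall>y\<in>\<Omega>. norm (g (y, u y)) \<le> m)" for r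
  proof -
    obtain m where m: "0 \<le> m" "\<And>y z. \<lbrakk>y \<in> \<Omega>; z \<in> Z; norm z \<le> C * r\<rbrakk> \<Longrightarrow> norm (G (y, z)) \<le> m"
      using nemytskii_bounded[OF \<Omega> G(1), where r="C * r"] by blast
    have "norm (g (y, u y)) \<le> m" if "u \<in> U" "\<forall>y\<in>\<Omega>. N\<^sub>n (u y) \<le> r" "y \<in> \<Omega>" for u y
    proof -
      have "norm (u y) \<le> C * N\<^sub>n (u y)" by (rule C)
      also have "\<dots> \<le> C * r" using that C by (intro mult_left_mono) auto
      finally show ?thesis using m(2) G(2) U_Z that by metis
    qed
    then show ?thesis using m(1) by blast
  qed

  have well_defined: "(\<forall>x\<in>\<Omega>\<^sub>1. integrable M (\<lambda>y. k x y *v g (y, u y))) \<and>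
      hammerstein M k g u \<in> holder_space N\<^sub>d \<beta> \<Omega>\<^sub>1" if u: "u \<in> U" for u
  proof -
    obtain r where "\<And>y. y \<in> \<Omega> \<Longrightarrow> N\<^sub>n (u y) \<le> r"
      using holder_space_sup_bound[OF U_space[OF u]] by blast
    then obtain m where m: "0 \<le> m" "\<And>y. y \<in> space M \<Longrightarrow> norm (g (y, u y)) \<le> m"
      using bound[of r] u M by blast
    have "holder_norm N\<^sub>d \<beta> \<Omega>\<^sub>1 (hammerstein M k g u) < \<infinity>"
      using operator[OF meas[OF u] m] unfolding hammerstein_def by (auto intro: le_less_trans)
    then show ?thesis
      using integrable[OF meas[OF u] m] exponents by (simp add: holder_norm_def holder_space_def)
  qed

  have bounded: "bounded_map (holder_norm N\<^sub>n \<alpha> \<Omega>) (holder_norm N\<^sub>d \<beta> \<Omega>\<^sub>1) U (hammerstein M k g)"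
    unfolding bounded_map_def
  proof (intro allI impI)
    fix B assume B: "B \<subseteq> U" "\<exists>r::real. \<forall>u\<in>B. holder_norm N\<^sub>n \<alpha> \<Omega> u \<le> ennreal r"
    then obtain r where r: "\<And>u. u \<in> B \<Longrightarrow> holder_norm N\<^sub>n \<alpha> \<Omega> u \<le> ennreal r" by blast
    obtain m where m: "0 \<le> m"
      "\<And>u y. \<lbrakk>u \<in> U; \<forall>y\<in>\<Omega>. N\<^sub>n (u y) \<le> max r 0; y \<in> \<Omega>\<rbrakk> \<Longrightarrow> norm (g (y, u y)) \<le> m"
      using bound[of "max r 0"] by blast
    have "holder_norm N\<^sub>d \<beta> \<Omega>\<^sub>1 (hammerstein M k g u) \<le> ennreal (D * m)" if "u \<in> B" for u
    proof -
      have "sup_norm N\<^sub>n \<Omega> u \<le> ennreal r" using sup_norm_le_holder_norm r[OF that] by (rule order_trans)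
      also have "\<dots> \<le> ennreal (max r 0)" by (rule ennreal_leI) simp
      finally have "\<forall>y\<in>\<Omega>. N\<^sub>n (u y) \<le> max r 0" by (simp add: sup_norm_le_iff)
      with that B(1) M(1) show ?thesis
        unfolding hammerstein_def by (intro operator meas m) auto
    qed
    then show "\<exists>R::real. \<forall>u\<in>B. holder_norm N\<^sub>d \<beta> \<Omega>\<^sub>1 (hammerstein M k g u) \<le> ennreal R" by blast
  qed

  have continuous: "norm_continuous_map (holder_norm N\<^sub>n \<alpha> \<Omega>) (holder_norm N\<^sub>d \<beta> \<Omega>\<^sub>1) U (hammerstein M k g)"
    unfolding norm_continuous_map_def
  proof (intro ballI allI impI)
    fix u \<epsilon> assume u: "u \<in> U" and \<epsilon>: "(0::real) < \<epsilon>"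
    obtain r where r: "\<And>y. y \<in> \<Omega> \<Longrightarrow> N\<^sub>n (u y) \<le> r"
      using holder_space_sup_bound[OF U_space[OF u]] by blast
    \<comment> \<open>Half of what the operator bound \<open>D\<close> allows, since the conclusion is a strict inequality.\<close>
    define m where "m = \<epsilon> / (2 * D)"
    have m: "0 < m" "D * m < \<epsilon>" using \<epsilon> D by (auto simp: m_def)
    obtain \<delta> where \<delta>: "0 < \<delta>"
      "\<And>y z z'. \<lbrakk>y \<in> \<Omega>; z \<in> Z; z' \<in> Z; norm z \<le> C * r; norm (z' - z) < \<delta>\<rbrakk>
         \<Longrightarrow> norm (G (y, z') - G (y, z)) < m"
      using nemytskii_continuous[OF \<Omega> G(1) m(1), where r="C * r"] by blast
    have "holder_norm N\<^sub>d \<beta> \<Omega>\<^sub>1 (hammerstein M k g v - hammerstein M k g u) < ennreal \<epsilon>"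
      if v: "v \<in> U" and near: "holder_norm N\<^sub>n \<alpha> \<Omega> (v - u) < ennreal (\<delta> / (2 * C))" for v
    proof -
      have "sup_norm N\<^sub>n \<Omega> (v - u) \<le> ennreal (\<delta> / (2 * C))"
        using sup_norm_le_holder_norm near by (rule order_trans[OF _ less_imp_le])
      then have sup: "\<And>y. y \<in> \<Omega> \<Longrightarrow> N\<^sub>n (v y - u y) \<le> \<delta> / (2 * C)"
        using \<delta>(1) C(1) by (simp add: sup_norm_le_iff)
      have small: "norm (g (y, v y) - g (y, u y)) \<le> m" if y: "y \<in> space M" for y
      proof -
        have y: "y \<in> \<Omega>" using y M by simp
        have "norm (v y - u y) \<le> C * (\<delta> / (2 * C))"
          using C sup[OF y] by (meson order_trans mult_left_mono less_imp_le)
        also have "\<dots> < \<delta>" using C \<delta>(1) by simp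
        finally have "norm (v y - u y) < \<delta>" .
        moreover have "norm (u y) \<le> C * r"
          using C r[OF y] by (meson order_trans mult_left_mono less_imp_le)
        ultimately show ?thesis
          using \<delta>(2)[OF y U_Z[OF u y] U_Z[OF v y]] G(2)[OF y U_Z[OF u y]] G(2)[OF y U_Z[OF v y]] by simp
      qed
      let ?f = "\<lambda>y. g (y, v y) - g (y, u y)"
      let ?T = "\<lambda>x. \<integral>y. k x y *v ?f y \<partial>M"
      have diff: "(hammerstein M k g v - hammerstein M k g u) x = ?T x" if x: "x \<in> \<Omega>\<^sub>1" for x
        using well_defined[OF u] well_defined[OF v] x
        by (simp add: hammerstein_def matrix_vector_mult_diff_distrib)
      have "holder_norm N\<^sub>d \<beta> \<Omega>\<^sub>1 (hammerstein M k g v - hammerstein M k g u) = holder_norm N\<^sub>d \<beta> \<Omega>\<^sub>1 ?T"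
        by (rule holder_norm_cong[OF diff])
      also have "\<dots> \<le> ennreal (D * m)"
        using m small by (intro operator borel_measurable_diff meas u v) auto
      also have "\<dots> < ennreal \<epsilon>" using m D by (simp add: ennreal_less_iff)
      finally show ?thesis .
    qed
    then show "\<exists>\<delta>>0::real. \<forall>v\<in>U. holder_norm N\<^sub>n \<alpha> \<Omega> (v - u) < ennreal \<delta> \<longrightarrow>
        holder_norm N\<^sub>d \<beta> \<Omega>\<^sub>1 (hammerstein M k g v - hammerstein M k g u) < ennreal \<epsilon>"
      using \<delta>(1) C(1) by (intro exI[of _ "\<delta> / (2 * C)"]) simp
  qed

  show ?thesis using well_defined bounded continuous by blast
qed

end
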